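(* Let $\mu,\nu$ be adapted random measures such that $(\mu(\cdot,[0,t]))_{t\in[0,T]}$ and $(\nu(\cdot,[0,t]))_{t\in[0,T]}$ are continuous processes and $\mu(\omega,\{0\})>0$ for all $\omega$. Let $p\in(1,\infty)$ and assume that $$\mathbb E\left|\int_{[0,T]}\mu([0,t])^{1/2}d\nu(t)\right|^p<\infty.$$ Then $$\left\|\int_{[0,T]}\mu([0,t])^{-1/2}d\mu(t)\right\|_p\left\|\int_{[0,T]}\mu([0,t])^{1/2}d\nu(t)\right\|_p\le2p\,\|\mu([0,T])\|_{p/2}\,\|\nu\|_{\mathrm{BMO}}.$$
   Context: Let $T>0$ and let $(A,\mathcal A,\mathbb Q,(\mathcal A_t)_{t\in[0,T]})$ be a stochastic basis such that $(A,\mathcal A,\mathbb Q)$ is complete, $(\mathcal A_t)$ is right-continuous, $\mathcal A_0$ contains all null-sets, and $\mathcal A=\mathcal A_T$. An adapted random measure is a map $\nu:A\times\mathcal B([0,T])\to[0,\infty)$ such that $\nu(\omega,\cdot)$ is a measure on $\mathcal B([0,T])$ for all $\omega\in A$ and $\nu(\cdot,[0,t])$ is $\mathcal A_t$-measurable for all $t\in[0,T]$. One sets $$\|\nu\|_{\mathrm{BMO}}:=\sup_{t\in[0,T]}\|\mathbb E(\nu([t,T])|\mathcal A_t)\|_\infty.$$ For $q\in(0,\infty)$, $\|X\|_q:=(\mathbb E|X|^q)^{1/q}$ (so $p/2<1$ is allowed). *)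

theory Defs
  imports "HOL-Probability.Probability"
begin

text \<open>
  The time index ranges over \<open>{0..T}\<close> only; the values \<open>F t\<close> for \<open>t\<close> outside that interval are
  unconstrained, and only \<open>space (F t)\<close> and \<open>sets (F t)\<close> matter.  As \<open>sets (F T) = sets M\<close>,
  monotonicity makes every \<open>F t\<close> a subalgebra of \<open>M\<close>.
\<close>

locale stochastic_basis = prob_space M + complete_measure M
  for M :: "'a measure" and F :: "real \<Rightarrow> 'a measure" and T :: real +
  assumes T_pos: "0 < T"
    and space_F: "\<And>t. t \<in> {0..T} \<Longrightarrow> space (F t) = space M"
    and sets_F_mono: "\<And>s t. 0 \<le> s \<Longrightarrow> s \<le> t \<Longrightarrow> t \<le> T \<Longrightarrow> sets (F s) \<subseteq> sets (F t)"
    and right_continuous: "\<And>t. t \<in> {0..<T} \<Longrightarrow> sets (F t) = (\<Inter>s\<in>{t<..T}. sets (F s))"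
    and null_sets_F0: "null_sets M \<subseteq> sets (F 0)"
    and sets_F_T: "sets (F T) = sets M"

text \<open>Since the space of \<open>\<nu> \<omega>\<close> is \<open>{0..T}\<close>, an integral with respect to \<open>\<nu> \<omega>\<close> is an integral
  over the closed interval, with any atom at \<open>0\<close> included.\<close>

definition adapted_random_measure ::
  "'a measure \<Rightarrow> (real \<Rightarrow> 'a measure) \<Rightarrow> real \<Rightarrow> ('a \<Rightarrow> real measure) \<Rightarrow> bool" where
  "adapted_random_measure M F T \<nu> \<longleftrightarrow>
     (\<forall>\<omega>\<in>space M. sets (\<nu> \<omega>) = sets (restrict_space borel {0..T}) \<and> finite_measure (\<nu> \<omega>)) \<and>
     (\<forall>t\<in>{0..T}. (\<lambda>\<omega>. measure (\<nu> \<omega>) {0..t}) \<in> borel_measurable (F t))"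

definition continuous_paths :: "'a measure \<Rightarrow> real \<Rightarrow> ('a \<Rightarrow> real measure) \<Rightarrow> bool" where
  "continuous_paths M T \<nu> \<longleftrightarrow>
     (\<forall>\<omega>\<in>space M. continuous_on {0..T} (\<lambda>t. measure (\<nu> \<omega>) {0..t}))"

text \<open>Both norms below may be infinite and so live in \<^typ>\<open>ennreal\<close>, where \<open>0 * \<infinity> = 0\<close>.\<close>

definition bmo_norm ::
  "'a measure \<Rightarrow> (real \<Rightarrow> 'a measure) \<Rightarrow> real \<Rightarrow> ('a \<Rightarrow> real measure) \<Rightarrow> ennreal" where
  "bmo_norm M F T \<nu> =
     (SUP t\<in>{0..T}. esssup M (nn_cond_exp M (F t) (\<lambda>\<omega>. emeasure (\<nu> \<omega>) {t..T})))"

definition Lq_norm :: "'a measure \<Rightarrow> real \<Rightarrow> ('a \<Rightarrow> real) \<Rightarrow> ennreal" where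
  "Lq_norm M q X =
     (let I = (\<integral>\<^sup>+\<omega>. ennreal (\<bar>X \<omega>\<bar> powr q) \<partial>M)
      in if I = \<infinity> then \<infinity> else ennreal (enn2real I powr (1 / q)))"

end

theory Submission
  imports Defs
begin

text \<open>
  Write \<open>m\<^sub>t = \<mu>([0,t])\<close>, \<open>W = m\<^sub>T powr (1/2)\<close> and
  \<open>X\<^sub>t = \<integral>\<^bsub>[0,t]\<^esub> m\<^sub>s powr (1/2) d\<nu>(s)\<close>.  The first factor is at most \<open>2 * \<parallel>W\<parallel>\<^sub>p\<close>, since pathwise
  \<open>\<integral> m powr (-1/2) dm \<le> 2 * W\<close>.  For the second one, the chain rule gives
  \<open>X\<^sub>T powr p \<le> p * \<integral> X powr (p-1) * m powr (1/2) d\<nu>\<close>.  The integrand is an adapted nondecreasing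
  process, so summation by parts and conditioning bound the expectation of the right-hand side by
  \<open>p * \<parallel>\<nu>\<parallel> * E[X\<^sub>T powr (p-1) * W]\<close> with the BMO norm of \<open>\<nu>\<close>, and Hoelder's inequality finishes the
  proof.  Everything is carried out for Riemann--Stieltjes sums over equidistant partitions, with
  Fatou's lemma passing to the limit.
\<close>

section \<open>Riemann--Stieltjes sums\<close>

text \<open>With \<open>g\<close> the distribution function of a measure on \<open>{0..T}\<close>,
  the leading term is the contribution of the atom at 0. The tags \<open>s\<close> are kept apart
  from the partition \<open>P\<close> because left endpoints are needed for one integrand and right
  endpoints for another.\<close>

definition stieltjes_sum ::
  "(real \<Rightarrow> real) \<Rightarrow> (real \<Rightarrow> real) \<Rightarrow> (nat \<Rightarrow> real) \<Rightarrow> (nat \<Rightarrow> real) \<Rightarrow> nat \<Rightarrow> real" where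
  "stieltjes_sum \<phi> g s P n =
     \<phi> 0 * g 0 + (\<Sum>k<n. \<phi> (s k) * (g (P (Suc k)) - g (P k)))"

text \<open>Left-open cells make the mass of each cell an increment of the distribution function.
  They leave out the point 0, which therefore gets its own term.\<close>

definition step_fun :: "(real \<Rightarrow> real) \<Rightarrow> (nat \<Rightarrow> real) \<Rightarrow> (nat \<Rightarrow> real) \<Rightarrow> nat \<Rightarrow> real \<Rightarrow> real" where
  "step_fun \<phi> s P n t =
     indicator {0} t * \<phi> 0 + (\<Sum>k<n. indicator {P k<..P (Suc k)} t * \<phi> (s k))"

lemma step_fun_zero:
  assumes "mono P" "P 0 = 0"
  shows "step_fun \<phi> s P n 0 = \<phi> 0"
proof -
  have "0 \<le> P k" for k
    using assms monoD[of P 0 k] by simp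
  then have "indicator {P k<..P (Suc k)} (0::real) = (0::real)" for k
    by (simp add: indicator_def not_less)
  then show ?thesis
    by (simp add: step_fun_def)
qed

lemma step_fun_interval:
  assumes "mono P" "P 0 = 0" "k < n" "t \<in> {P k<..P (Suc k)}"
  shows "step_fun \<phi> s P n t = \<phi> (s k)"
proof -
  have t: "0 < t"
    using assms monoD[of P 0 k] by auto
  have "indicator {P j<..P (Suc j)} t = (0::real)" if "j \<noteq> k" for j
  proof (cases "j < k")
    case True
    then show ?thesis
      using monoD[OF assms(1), of "Suc j" k] assms(4) by (auto simp: indicator_def)
  next
    case False
    then show ?thesis
      using monoD[OF assms(1), of "Suc k" j] assms(4) that by (auto simp: indicator_def)
  qed
  then have "(\<Sum>j<n. indicator {P j<..P (Suc j)} t * \<phi> (s j)) =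
      (\<Sum>j\<in>{k}. indicator {P j<..P (Suc j)} t * \<phi> (s j))"
    using assms(3) by (intro sum.mono_neutral_right) auto
  also have "\<dots> = \<phi> (s k)"
    using assms(4) by simp
  finally show ?thesis
    using t by (simp add: step_fun_def)
qed

text \<open>If \<open>t\<close> were positive and outside all cells, induction would push every
  \<open>P k\<close> strictly below \<open>t\<close>, contradicting \<open>P n = T\<close>.\<close>

lemma partition_cases:
  fixes P :: "nat \<Rightarrow> real"
  assumes "P 0 = 0" "P n = T" "t \<in> {0..T}"
  obtains "t = 0" | k where "k < n" "t \<in> {P k<..P (Suc k)}"
proof -
  have "t = 0 \<or> (\<exists>k<n. t \<in> {P k<..P (Suc k)})"
  proof (rule ccontr)
    assume *: "\<not> ?thesis"
    have "P k < t" if "k \<le> n" for k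
      using that
    proof (induction k)
      case 0
      then show ?case using * assms by auto
    next
      case (Suc k)
      then show ?case using * by (force simp: not_le)
    qed
    then show False
      using assms by force
  qed
  then show thesis
    using that by blast
qed

text \<open>Models a random measure at one fixed outcome. Pathwise arguments take place here and are
  transferred by interpretation at each \<open>\<omega>\<close>.\<close>

locale interval_measure = finite_measure \<kappa> for \<kappa> :: "real measure" +
  fixes T :: real
  assumes T_pos: "0 < T"
    and sets_interval: "sets \<kappa> = sets (restrict_space borel {0..T})"
begin

lemma space_interval: "space \<kappa> = {0..T}"
  using sets_eq_imp_space_eq[OF sets_interval] by (simp add: space_restrict_space)

lemma borel_in_sets: "A \<in> sets borel \<Longrightarrow> A \<subseteq> {0..T} \<Longrightarrow> A \<in> sets \<kappa>"
  by (auto simp: sets_interval sets_restrict_space_iff)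

lemma measurable_continuous_on: "continuous_on {0..T} f \<Longrightarrow> f \<in> borel_measurable \<kappa>"
  using measurable_cong_sets[OF sets_interval refl] borel_measurable_continuous_on_restrict by blast

lemma integrable_continuous_on:
  fixes f :: "real \<Rightarrow> real"
  assumes "continuous_on {0..T} f"
  shows "integrable \<kappa> f"
proof -
  have "bounded (f ` {0..T})"
    using assms by (intro compact_imp_bounded compact_continuous_image) auto
  then obtain B where "\<And>t. t \<in> {0..T} \<Longrightarrow> norm (f t) \<le> B"
    unfolding bounded_iff by blast
  then show ?thesis
    using measurable_continuous_on[OF assms] space_interval
    by (intro integrable_const_bound[where B=B]) auto
qed

lemma measure_Ioc:
  assumes "0 \<le> a" "a \<le> b" "b \<le> T"
  shows "measure \<kappa> {a<..b} = measure \<kappa> {0..b} - measure \<kappa> {0..a}"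
proof -
  have "{a<..b} = {0..b} - {0..a}"
    using assms by auto
  then show ?thesis
    using assms by (simp add: finite_measure_Diff borel_in_sets)
qed

text \<open>Turns statements about sums into pointwise comparisons of \<open>\<phi>\<close> with a
  step function under one integral.\<close>

lemma has_integral_step_fun:
  assumes "mono P" "P 0 = 0" "P n = T"
  shows "has_bochner_integral \<kappa> (step_fun \<phi> s P n)
    (stieltjes_sum \<phi> (\<lambda>t. measure \<kappa> {0..t}) s P n)"
proof -
  have P: "0 \<le> P k" "P k \<le> P (Suc k)" for k
    using assms monoD[OF assms(1), of 0 k] monoD[OF assms(1), of k "Suc k"] by auto
  have PT: "P (Suc k) \<le> T" if "k < n" for k
    using assms monoD[OF assms(1), of "Suc k" n] that by auto
  have ind: "has_bochner_integral \<kappa> (\<lambda>t. indicator A t * c) (c * measure \<kappa> A)"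
    if "A \<in> sets borel" "A \<subseteq> {0..T}" for A and c :: real
  proof -
    have "has_bochner_integral \<kappa> (indicator A) (measure \<kappa> A)"
      using borel_in_sets[OF that] by (intro has_bochner_integral_real_indicator) (auto simp: less_top[symmetric])
    from has_bochner_integral_mult_left[OF this, of c] show ?thesis
      by (simp add: mult.commute)
  qed
  have "has_bochner_integral \<kappa>
      (\<lambda>t. \<Sum>k<n. indicator {P k<..P (Suc k)} t * \<phi> (s k))
      (\<Sum>k<n. \<phi> (s k) * measure \<kappa> {P k<..P (Suc k)})"
  proof (rule has_bochner_integral_sum)
    fix k assume "k \<in> {..<n}"
    then have "{P k<..P (Suc k)} \<subseteq> {0..T}"
      using P(1)[of k] PT[of k] by auto
    then show "has_bochner_integral \<kappa> (\<lambda>t. indicator {P k<..P (Suc k)} t * \<phi> (s k))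
        (\<phi> (s k) * measure \<kappa> {P k<..P (Suc k)})"
      by (intro ind) auto
  qed
  moreover have "has_bochner_integral \<kappa> (\<lambda>t. indicator {0} t * \<phi> 0) (\<phi> 0 * measure \<kappa> {0})"
    using T_pos by (intro ind) auto
  ultimately have "has_bochner_integral \<kappa> (step_fun \<phi> s P n)
      (\<phi> 0 * measure \<kappa> {0} + (\<Sum>k<n. \<phi> (s k) * measure \<kappa> {P k<..P (Suc k)}))"
    unfolding step_fun_def by (rule has_bochner_integral_add[rotated])
  then show ?thesis
    using P PT by (simp add: stieltjes_sum_def measure_Ioc)
qed

text \<open>With left endpoints as tags, the step function of a nondecreasing \<open>\<phi>\<close>
  stays below \<open>\<phi>\<close>.\<close>

lemma stieltjes_sum_le_integral:
  assumes "mono P" "P 0 = 0" "P n = T" "continuous_on {0..T} \<phi>" "mono_on {0..T} \<phi>"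
  shows "stieltjes_sum \<phi> (\<lambda>t. measure \<kappa> {0..t}) P P n \<le> (\<integral>t. \<phi> t \<partial>\<kappa>)"
proof -
  note step = has_integral_step_fun[OF assms(1-3), of \<phi> P]
  have "(\<integral>t. step_fun \<phi> P P n t \<partial>\<kappa>) \<le> (\<integral>t. \<phi> t \<partial>\<kappa>)"
  proof (rule integral_mono)
    show "integrable \<kappa> (step_fun \<phi> P P n)"
      using step by (simp add: has_bochner_integral_iff)
    show "integrable \<kappa> \<phi>"
      by (rule integrable_continuous_on[OF assms(4)])
    fix t assume "t \<in> space \<kappa>"
    then have t: "t \<in> {0..T}"
      by (simp add: space_interval)
    with assms(2,3) show "step_fun \<phi> P P n t \<le> \<phi> t"
    proof (cases rule: partition_cases)
      case 1
      then show ?thesis using assms by (simp add: step_fun_zero)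
    next
      case (2 k)
      moreover have "0 \<le> P k"
        using assms monoD[OF assms(1), of 0 k] by simp
      ultimately have "\<phi> (P k) \<le> \<phi> t"
        using t by (intro mono_onD[OF assms(5)]) auto
      then show ?thesis
        using step_fun_interval[OF assms(1,2) 2] by simp
    qed
  qed
  then show ?thesis
    using step by (simp add: has_bochner_integral_iff)
qed

end

text \<open>Index \<open>n\<close> means \<open>n + 1\<close> cells, so the denominator never
  vanishes; full sums over this partition are therefore taken at \<open>Suc n\<close>.\<close>

definition grid :: "real \<Rightarrow> nat \<Rightarrow> nat \<Rightarrow> real" where
  "grid T n k = T * real k / real (Suc n)"

lemma grid_0 [simp]: "grid T n 0 = 0" and grid_Suc_n [simp]: "grid T n (Suc n) = T"
  by (simp_all add: grid_def del: of_nat_Suc)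

lemma mono_grid: "0 < T \<Longrightarrow> mono (grid T n)"
  unfolding grid_def by (intro monoI divide_right_mono mult_left_mono) auto

lemma grid_bounds: "0 < T \<Longrightarrow> 0 \<le> grid T n k" "0 < T \<Longrightarrow> k \<le> Suc n \<Longrightarrow> grid T n k \<le> T"
  using monoD[OF mono_grid, of T 0 k n] monoD[OF mono_grid, of T k "Suc n" n] by auto

lemma grid_step: "grid T n (Suc k) - grid T n k = T / real (Suc n)"
proof -
  have "T * real (Suc k) - T * real k = T"
    by (simp add: algebra_simps)
  then show ?thesis
    unfolding grid_def diff_divide_distrib[symmetric] by simp
qed

lemma eventually_grid_step_less:
  assumes "0 < d"
  shows "eventually (\<lambda>n. T / real (Suc n) < d) sequentially"
proof -
  have "(\<lambda>n. T / real (Suc n)) \<longlonglongrightarrow> 0"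
    by real_asymp
  then show ?thesis
    using assms by (rule order_tendstoD)
qed

text \<open>By uniform continuity of \<open>\<phi>\<close> the step functions converge to it
  uniformly, whatever the tags in the closed cells, and the total mass is finite.\<close>

lemma (in interval_measure) stieltjes_sum_tendsto:
  assumes cont: "continuous_on {0..T} \<phi>"
    and tag: "\<And>n k. k \<le> n \<Longrightarrow> s n k \<in> {grid T n k..grid T n (Suc k)}"
  shows "(\<lambda>n. stieltjes_sum \<phi> (\<lambda>t. measure \<kappa> {0..t}) (s n) (grid T n) (Suc n))
           \<longlonglongrightarrow> (\<integral>t. \<phi> t \<partial>\<kappa>)"
proof (rule LIMSEQ_I)
  fix r :: real assume r: "0 < r"
  \<comment> \<open>The summand 1 covers a vanishing total mass and makes the final comparison of
    \<open>\<epsilon>\<close> times the mass with \<open>r\<close> strict.\<close>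
  define \<epsilon> where "\<epsilon> = r / (measure \<kappa> {0..T} + 1)"
  have \<epsilon>: "0 < \<epsilon>"
    unfolding \<epsilon>_def by (intro divide_pos_pos r) (simp add: add_nonneg_pos)
  have "uniformly_continuous_on {0..T} \<phi>"
    using cont by (intro compact_uniformly_continuous) auto
  then obtain d where d: "0 < d"
    "\<And>x y. x \<in> {0..T} \<Longrightarrow> y \<in> {0..T} \<Longrightarrow> dist y x < d \<Longrightarrow> dist (\<phi> y) (\<phi> x) < \<epsilon>"
    using \<epsilon> unfolding uniformly_continuous_on_def by metis
  obtain N where N: "\<And>n. N \<le> n \<Longrightarrow> T / real (Suc n) < d"
    using eventually_grid_step_less[OF d(1), of T] unfolding eventually_sequentially by blast
  have "norm (stieltjes_sum \<phi> (\<lambda>t. measure \<kappa> {0..t}) (s n) (grid T n) (Suc n)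
      - (\<integral>t. \<phi> t \<partial>\<kappa>)) < r" if n: "N \<le> n" for n
  proof -
    define f where "f = step_fun \<phi> (s n) (grid T n) (Suc n)"
    have step: "has_bochner_integral \<kappa> f
        (stieltjes_sum \<phi> (\<lambda>t. measure \<kappa> {0..t}) (s n) (grid T n) (Suc n))"
      unfolding f_def by (intro has_integral_step_fun mono_grid T_pos grid_0 grid_Suc_n)
    have int: "integrable \<kappa> f" "integrable \<kappa> \<phi>"
      using step integrable_continuous_on[OF cont] by (simp_all add: f_def has_bochner_integral_iff)
    have close: "norm (f t - \<phi> t) \<le> \<epsilon>" if "t \<in> space \<kappa>" for t
    proof -
      have t: "t \<in> {0..T}"
        using that by (simp add: space_interval)
      from grid_0[of T n] grid_Suc_n[of T n] this show ?thesis
      proof (cases rule: partition_cases)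
        case 1
        then show ?thesis
          using \<epsilon> by (simp add: f_def step_fun_zero mono_grid T_pos)
      next
        case (2 k)
        have s: "s n k \<in> {grid T n k..grid T n (Suc k)}"
          using 2 tag by simp
        have "s n k \<in> {0..T}"
          using s 2 grid_bounds(1)[OF T_pos, of n k] grid_bounds(2)[OF T_pos, of "Suc k" n] by auto
        moreover have "dist (s n k) t < d"
          using s 2 grid_step[of T n k] N[OF n] by (auto simp: dist_real_def)
        ultimately have "dist (\<phi> (s n k)) (\<phi> t) < \<epsilon>"
          using d(2) t by blast
        then show ?thesis
          using step_fun_interval[OF mono_grid[OF T_pos] grid_0 2, of \<phi> "s n"]
          by (simp add: f_def dist_real_def)
      qed
    qed
    have "norm (\<integral>t. f t - \<phi> t \<partial>\<kappa>) \<le> (\<integral>t. \<epsilon> \<partial>\<kappa>)"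
      by (rule Bochner_Integration.integral_norm_bound_integral) (use int close in auto)
    also have "\<dots> = \<epsilon> * measure \<kappa> {0..T}"
      by (simp add: space_interval)
    also have "\<dots> < r"
    proof -
      have "0 < measure \<kappa> {0..T} + 1"
        by (simp add: add_nonneg_pos)
      then show ?thesis
        using r by (simp add: \<epsilon>_def pos_divide_less_eq distrib_left)
    qed
    finally show ?thesis
      using int step by (simp add: f_def has_bochner_integral_iff)
  qed
  then show "\<exists>N. \<forall>n\<ge>N. norm (stieltjes_sum \<phi> (\<lambda>t. measure \<kappa> {0..t}) (s n) (grid T n) (Suc n)
      - (\<integral>t. \<phi> t \<partial>\<kappa>)) < r"
    by blast
qed

section \<open>Powers of Riemann--Stieltjes sums\<close>

text \<open>This is convexity: the graph of the power function lies above its tangent at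
  \<open>b\<close>. Young's inequality for \<open>a * b powr (p - 1)\<close> yields it without
  derivatives, so zero values of \<open>a\<close> and \<open>b\<close> need no separate limit
  argument.\<close>

lemma powr_diff_le:
  fixes a b p :: real
  assumes "1 < p" "0 \<le> a" "0 \<le> b"
  shows "b powr p - a powr p \<le> p * (b powr (p - 1) * (b - a))"
proof -
  define q where "q = p / (p - 1)"
  have q: "1 < q" "1 / p + 1 / q = 1" "(p - 1) * q = p"
    using assms by (simp_all add: q_def field_simps)
  have "a * b powr (p - 1) \<le> a powr p / p + (b powr (p - 1)) powr q / q"
    using assms q by (intro Youngs_inequality) auto
  also have "(b powr (p - 1)) powr q = b powr p"
    using q by (simp add: powr_powr)
  also have "b powr p / q = b powr p - b powr p / p"
    using assms by (simp add: q_def field_simps)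
  finally have "p * (a * b powr (p - 1)) \<le> a powr p + p * b powr p - b powr p"
    using assms by (simp add: field_simps)
  moreover have "b powr p = b powr (p - 1) * b"
    using assms by (cases "b = 0") (simp_all add: powr_mult_base' powr_diff)
  ultimately show ?thesis
    by (simp add: algebra_simps)
qed

text \<open>A discrete chain rule. Convexity bounds each increment of \<open>S powr p\<close> with
  the weight at the right endpoint; moving it to the left endpoint costs an error, and these errors
  telescope.\<close>

lemma powr_sum_le:
  fixes S w d :: "nat \<Rightarrow> real"
  assumes p: "1 < p" and S0: "0 \<le> S 0"
    and S: "\<And>k. k < n \<Longrightarrow> S (Suc k) = S k + w k * d k"
    and w: "\<And>k. k < n \<Longrightarrow> 0 \<le> w k \<and> w k \<le> W"
    and d: "\<And>k. k < n \<Longrightarrow> 0 \<le> d k \<and> d k \<le> \<delta>"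
    and W: "0 \<le> W" "0 \<le> \<delta>"
  shows "S n powr p \<le> p * ((S 0 powr (p - 1) * S 0 + (\<Sum>k<n. S k powr (p - 1) * (w k * d k)))
    + W * \<delta> * S n powr (p - 1))"
proof -
  have "0 \<le> S k \<and> S k powr p \<le> p * ((S 0 powr (p - 1) * S 0 +
      (\<Sum>j<k. S j powr (p - 1) * (w j * d j))) + W * \<delta> * S k powr (p - 1))" if "k \<le> n" for k
    using that
  proof (induction k)
    case 0
    have "S 0 powr p = S 0 powr (p - 1) * S 0"
      using S0 by (cases "S 0 = 0") (simp_all add: powr_mult_base' powr_diff)
    moreover have "1 * (S 0 powr (p - 1) * S 0) \<le> p * (S 0 powr (p - 1) * S 0)"
      using p S0 by (intro mult_right_mono) auto
    moreover have "0 \<le> p * (W * \<delta> * S 0 powr (p - 1))"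
      using p W by simp
    ultimately show ?case
      using S0 by (simp add: distrib_left)
  next
    case (Suc k)
    then have k: "k < n" and IH: "0 \<le> S k" "S k powr p \<le> p * ((S 0 powr (p - 1) * S 0 +
        (\<Sum>j<k. S j powr (p - 1) * (w j * d j))) + W * \<delta> * S k powr (p - 1))"
      by auto
    define e where "e = w k * d k"
    have e: "0 \<le> e" "e \<le> W * \<delta>"
      using w[OF k] d[OF k] W by (auto simp: e_def intro!: mult_mono)
    have Suc_k: "S (Suc k) = S k + e"
      using S[OF k] by (simp add: e_def)
    have "S k powr (p - 1) \<le> S (Suc k) powr (p - 1)"
      using p IH(1) e by (intro powr_mono2) (auto simp: Suc_k)
    \<comment> \<open>Replacing the increment \<open>e\<close> by its uniform bound
      \<open>W * \<delta>\<close> leaves a constant times an increment of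
      \<open>S powr (p - 1)\<close>, which is what telescopes.\<close>
    then have "(S (Suc k) powr (p - 1) - S k powr (p - 1)) * e \<le>
        (S (Suc k) powr (p - 1) - S k powr (p - 1)) * (W * \<delta>)"
      using e by (intro mult_left_mono) auto
    then have "p * (S (Suc k) powr (p - 1) * e) \<le>
        p * (S k powr (p - 1) * e + (S (Suc k) powr (p - 1) - S k powr (p - 1)) * (W * \<delta>))"
      using p by (intro mult_left_mono) (auto simp: algebra_simps)
    moreover have "S (Suc k) powr p - S k powr p \<le> p * (S (Suc k) powr (p - 1) * e)"
      using powr_diff_le[OF p IH(1), of "S (Suc k)"] IH(1) e by (simp add: Suc_k)
    ultimately have "S (Suc k) powr p \<le> p * ((S 0 powr (p - 1) * S 0 +
        (\<Sum>j<Suc k. S j powr (p - 1) * (w j * d j))) + W * \<delta> * S (Suc k) powr (p - 1))"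
      using IH(2) by (simp add: e_def algebra_simps)
    then show ?case
      using IH(1) e by (simp add: Suc_k)
  qed
  then show ?thesis
    by blast
qed

text \<open>Moves the differences from \<open>g\<close> to \<open>y\<close>, so that each increment
  of \<open>y\<close> is paired with the mass that \<open>g\<close> still has to collect.\<close>

lemma summation_by_parts:
  fixes y g :: "nat \<Rightarrow> real"
  shows "y 0 * g 0 + (\<Sum>k<Suc n. y k * (g (Suc k) - g k)) =
    y 0 * g (Suc n) + (\<Sum>k<n. (y (Suc k) - y k) * (g (Suc n) - g (Suc k)))"
proof -
  \<comment> \<open>Freeing the end value as \<open>G\<close> makes the induction go through. For
    \<open>G = g (Suc n)\<close> the last term becomes the summand with
    \<open>k = n\<close>.\<close>
  have "y 0 * G + (\<Sum>k<n. (y (Suc k) - y k) * (G - g (Suc k))) =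
      y 0 * g 0 + (\<Sum>k<n. y k * (g (Suc k) - g k)) + y n * (G - g n)" for G
    by (induction n) (simp_all add: algebra_simps)
  then show ?thesis
    by simp
qed

lemma stieltjes_sum_0 [simp]: "stieltjes_sum \<phi> g s P 0 = \<phi> 0 * g 0"
  by (simp add: stieltjes_sum_def)

lemma stieltjes_sum_Suc [simp]:
  "stieltjes_sum \<phi> g s P (Suc n) =
     stieltjes_sum \<phi> g s P n + \<phi> (s n) * (g (P (Suc n)) - g (P n))"
  by (simp add: stieltjes_sum_def)

text \<open>The integrand is sampled at left endpoints so that it is adapted to the discretised filtration;
  convexity of the power function would call for right endpoints, and the error this causes is
  controlled by the largest increment of \<open>g\<close> (the term \<open>W * \<delta> * S n powr (p - 1)\<close> above).\<close>

definition powr_stieltjes_sum ::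
  "real \<Rightarrow> (real \<Rightarrow> real) \<Rightarrow> (real \<Rightarrow> real) \<Rightarrow> (nat \<Rightarrow> real) \<Rightarrow> nat \<Rightarrow> real" where
  "powr_stieltjes_sum p w g P n =
     (stieltjes_sum w g P P 0 powr (p - 1) * w 0) * g 0 +
     (\<Sum>k<n. (stieltjes_sum w g P P k powr (p - 1) * w (P k)) * (g (P (Suc k)) - g (P k)))"

text \<open>Pathwise chain rule in the limit: the discrete version holds on every grid, and its
  error vanishes with the largest increment of the distribution function. A lower limit suffices
  because Fatou's lemma follows.\<close>

lemma (in interval_measure) powr_integral_le_liminf:
  assumes p: "1 < p"
    and w: "continuous_on {0..T} w" "mono_on {0..T} w" "0 \<le> w 0"
    and g: "continuous_on {0..T} (\<lambda>t. measure \<kappa> {0..t})"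
  shows "ennreal ((\<integral>t. w t \<partial>\<kappa>) powr p) \<le>
    liminf (\<lambda>n. ennreal (p * powr_stieltjes_sum p w (\<lambda>t. measure \<kappa> {0..t}) (grid T n) (Suc n)))"
proof -
  define g where "g = (\<lambda>t. measure \<kappa> {0..t})"
  define X where "X = (\<integral>t. w t \<partial>\<kappa>)"
  define S where "S n k = stieltjes_sum w g (grid T n) (grid T n) k" for n k
  define D where "D n k = g (grid T n (Suc k)) - g (grid T n k)" for n k
  define \<delta> where "\<delta> n = Max (D n ` {..n})" for n
  have grid_in: "grid T n k \<in> {0..T}" if "k \<le> Suc n" for n k
    using that grid_bounds[OF T_pos] by simp
  have grid_le: "grid T n k \<le> grid T n (Suc k)" for n k
    using monoD[OF mono_grid[OF T_pos]] by simp
  have w_bound: "0 \<le> w t \<and> w t \<le> w T" if "t \<in> {0..T}" for t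
    using that w(3) mono_onD[OF w(2), of 0 t] mono_onD[OF w(2), of t T] T_pos by auto
  have g_nonneg: "0 \<le> g t" for t
    by (simp add: g_def)
  have g_mono: "g s \<le> g t" if "s \<le> t" "t \<le> T" for s t
    unfolding g_def using that by (intro finite_measure_mono borel_in_sets) auto
  have D: "0 \<le> D n k \<and> D n k \<le> \<delta> n" if "k < Suc n" for n k
  proof
    show "0 \<le> D n k"
      using that g_mono[OF grid_le] grid_in[of "Suc k" n] by (simp add: D_def)
    show "D n k \<le> \<delta> n"
      unfolding \<delta>_def using that by (intro Max_ge) auto
  qed
  \<comment> \<open>Continuity of the distribution function enters here, through its uniform
    continuity on the compact interval.\<close>
  have "\<delta> \<longlonglongrightarrow> 0"
  proof (rule LIMSEQ_I)
    fix r :: real assume r: "0 < r"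
    have "uniformly_continuous_on {0..T} g"
      using g unfolding g_def by (intro compact_uniformly_continuous) auto
    then obtain d where d: "0 < d"
      "\<And>x y. x \<in> {0..T} \<Longrightarrow> y \<in> {0..T} \<Longrightarrow> dist y x < d \<Longrightarrow> dist (g y) (g x) < r"
      using r unfolding uniformly_continuous_on_def by metis
    obtain N where N: "\<And>n. N \<le> n \<Longrightarrow> T / real (Suc n) < d"
      using eventually_grid_step_less[OF d(1), of T] unfolding eventually_sequentially by blast
    have "norm (\<delta> n - 0) < r" if "N \<le> n" for n
    proof -
      have "D n k < r" if "k \<le> n" for k
      proof -
        have "dist (grid T n (Suc k)) (grid T n k) < d"
          using N[OF \<open>N \<le> n\<close>] grid_step[of T n k] T_pos by (simp add: dist_real_def)
        then have "dist (g (grid T n (Suc k))) (g (grid T n k)) < r"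
          using that by (intro d(2) grid_in) auto
        then show ?thesis
          by (simp add: D_def dist_real_def)
      qed
      then have "\<delta> n < r"
        by (simp add: \<delta>_def)
      moreover have "0 \<le> \<delta> n"
        using D[of 0 n] by auto
      ultimately show ?thesis
        by simp
    qed
    then show "\<exists>N. \<forall>n\<ge>N. norm (\<delta> n - 0) < r"
      by blast
  qed
  have S_lim: "(\<lambda>n. S n (Suc n)) \<longlonglongrightarrow> X"
    unfolding S_def X_def g_def using grid_le by (intro stieltjes_sum_tendsto w) auto
  have S_nonneg: "0 \<le> S n k" if "k \<le> Suc n" for n k
    using that
  proof (induction k)
    case 0
    then show ?case using w(3) g_nonneg by (simp add: S_def)
  next
    case (Suc k)
    then show ?case
      using w_bound[OF grid_in, of k n] D[of k n] by (simp add: S_def D_def)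
  qed
  \<comment> \<open>The limit \<open>X\<close> may be 0; the sums are nonnegative and both exponents
    are positive, so the powers still converge.\<close>
  have "(\<lambda>n. S n (Suc n) powr p - p * (w T * \<delta> n * S n (Suc n) powr (p - 1)))
      \<longlonglongrightarrow> X powr p - p * (w T * 0 * X powr (p - 1))"
    using p S_nonneg by (intro tendsto_intros S_lim \<open>\<delta> \<longlonglongrightarrow> 0\<close>) auto
  then have "(\<lambda>n. ennreal (S n (Suc n) powr p - p * (w T * \<delta> n * S n (Suc n) powr (p - 1))))
      \<longlonglongrightarrow> ennreal (X powr p)"
    by (intro tendsto_ennrealI) simp
  then have "ennreal (X powr p) =
      liminf (\<lambda>n. ennreal (S n (Suc n) powr p - p * (w T * \<delta> n * S n (Suc n) powr (p - 1))))"
    by (intro lim_imp_Liminf[symmetric]) auto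
  also have "\<dots> \<le> liminf (\<lambda>n. ennreal (p * powr_stieltjes_sum p w g (grid T n) (Suc n)))"
  proof (intro Liminf_mono always_eventually allI ennreal_leI)
    fix n
    have "S n (Suc n) powr p \<le> p * ((S n 0 powr (p - 1) * S n 0 +
        (\<Sum>k<Suc n. S n k powr (p - 1) * (w (grid T n k) * D n k)))
        + w T * \<delta> n * S n (Suc n) powr (p - 1))"
      using D[of 0 n] w_bound[of T] T_pos
      by (intro powr_sum_le p S_nonneg D w_bound grid_in)
        (auto simp: S_def D_def)
    then show "S n (Suc n) powr p - p * (w T * \<delta> n * S n (Suc n) powr (p - 1))
        \<le> p * powr_stieltjes_sum p w g (grid T n) (Suc n)"
      unfolding powr_stieltjes_sum_def S_def[symmetric] D_def[symmetric]
      by (simp add: S_def[of n 0] algebra_simps)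
  qed
  finally show ?thesis
    by (simp add: X_def g_def)
qed

section \<open>Integrals against random measures of bounded mean oscillation\<close>

context stochastic_basis
begin

lemma subalgebra_F: "t \<in> {0..T} \<Longrightarrow> subalgebra M (F t)"
  using sets_F_mono[of t T] by (simp add: subalgebra_def space_F sets_F_T)

lemma measurable_F_mono:
  assumes "f \<in> borel_measurable (F s)" "0 \<le> s" "s \<le> t" "t \<le> T"
  shows "f \<in> borel_measurable (F t)"
proof -
  have "subalgebra (F t) (F s)"
    using assms sets_F_mono[of s t] by (simp add: subalgebra_def space_F)
  then show ?thesis
    using assms(1) by (rule measurable_from_subalg)
qed

lemma measurable_F_M: "f \<in> borel_measurable (F t) \<Longrightarrow> t \<in> {0..T} \<Longrightarrow> f \<in> borel_measurable M"
  using measurable_from_subalg[OF subalgebra_F] by blast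

lemma interval_measure_adapted:
  "adapted_random_measure M F T \<nu> \<Longrightarrow> \<omega> \<in> space M \<Longrightarrow> interval_measure (\<nu> \<omega>) T"
  using T_pos by (simp add: adapted_random_measure_def interval_measure_def interval_measure_axioms_def)

lemma adapted_measurable_F:
  "adapted_random_measure M F T \<nu> \<Longrightarrow> t \<in> {0..T} \<Longrightarrow>
    (\<lambda>\<omega>. measure (\<nu> \<omega>) {0..t}) \<in> borel_measurable (F t)"
  by (simp add: adapted_random_measure_def)

lemma adapted_measurable_M:
  "adapted_random_measure M F T \<nu> \<Longrightarrow> t \<in> {0..T} \<Longrightarrow>
    (\<lambda>\<omega>. measure (\<nu> \<omega>) {0..t}) \<in> borel_measurable M"
  using adapted_measurable_F measurable_F_M by blast

text \<open>Adaptedness speaks only of the intervals \<open>{0..t}\<close>. The tail is the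
  complement of \<open>{0..<t}\<close>, and the mass of the latter is a limit of masses of such
  closed intervals.\<close>

lemma measurable_emeasure_tail:
  assumes "adapted_random_measure M F T \<nu>" "t \<in> {0..T}"
  shows "(\<lambda>\<omega>. emeasure (\<nu> \<omega>) {t..T}) \<in> borel_measurable M"
proof -
  have "(\<lambda>\<omega>. measure (\<nu> \<omega>) {t..T}) \<in> borel_measurable M"
  proof (cases "t = 0")
    case True
    then show ?thesis
      using adapted_measurable_M[OF assms(1), of T] T_pos by simp
  next
    case False
    then have t: "0 < t" "t \<le> T"
      using assms by auto
    \<comment> \<open>Starts at 0 and increases to \<open>t\<close> without reaching it, so it stays
      inside the time interval.\<close>
    define a where "a n = t - t / real (Suc n)" for n
    have a: "0 \<le> a n" "a n < t" for n
      using t by (auto simp: a_def field_simps)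
    have "(\<lambda>n. measure (\<nu> \<omega>) {0..a n}) \<longlonglongrightarrow> measure (\<nu> \<omega>) {0..<t}"
      if "\<omega> \<in> space M" for \<omega>
    proof -
      interpret interval_measure "\<nu> \<omega>" T
        by (rule interval_measure_adapted[OF assms(1) that])
      have "incseq a"
        unfolding a_def using t by (intro monoI diff_mono divide_left_mono) auto
      then have "incseq (\<lambda>n. {0..a n})"
        by (auto simp: incseq_def intro: order_trans)
      moreover have "{0..a n} \<in> sets (\<nu> \<omega>)" for n
        using a[of n] t by (intro borel_in_sets) auto
      ultimately have "(\<lambda>n. measure (\<nu> \<omega>) {0..a n}) \<longlonglongrightarrow> measure (\<nu> \<omega>) (\<Union>n. {0..a n})"
        by (intro finite_Lim_measure_incseq) auto
      moreover have "(\<Union>n. {0..a n}) = {0..<t}"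
      proof -
        have "\<exists>n. x \<le> a n" if "0 \<le> x" "x < t" for x
        proof -
          have "a \<longlonglongrightarrow> t"
            unfolding a_def by real_asymp
          then have "eventually (\<lambda>n. x < a n) sequentially"
            using that(2) by (rule order_tendstoD)
          then show ?thesis
            by (auto simp: eventually_sequentially intro: less_imp_le)
        qed
        then show ?thesis
          using a(1) by (auto intro: le_less_trans[OF _ a(2)])
      qed
      ultimately show ?thesis
        by simp
    qed
    moreover have "(\<lambda>\<omega>. measure (\<nu> \<omega>) {0..a n}) \<in> borel_measurable M" for n
      using a[of n] t by (intro adapted_measurable_M[OF assms(1)]) auto
    ultimately have "(\<lambda>\<omega>. measure (\<nu> \<omega>) {0..<t}) \<in> borel_measurable M"
      by (rule borel_measurable_LIMSEQ_real)
    then have "(\<lambda>\<omega>. measure (\<nu> \<omega>) {0..T} - measure (\<nu> \<omega>) {0..<t}) \<in> borel_measurable M"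
      using adapted_measurable_M[OF assms(1), of T] T_pos by simp
    moreover have "measure (\<nu> \<omega>) {t..T} = measure (\<nu> \<omega>) {0..T} - measure (\<nu> \<omega>) {0..<t}"
      if "\<omega> \<in> space M" for \<omega>
    proof -
      interpret interval_measure "\<nu> \<omega>" T
        by (rule interval_measure_adapted[OF assms(1) that])
      have "{t..T} = {0..T} - {0..<t}"
        using t by auto
      moreover have "{0..<t} \<in> sets (\<nu> \<omega>)" "{0..T} \<in> sets (\<nu> \<omega>)"
        using t by (auto intro!: borel_in_sets)
      moreover have "{0..<t} \<subseteq> {0..T}"
        using t by auto
      ultimately show ?thesis
        using finite_measure_Diff[of "{0..T}" "{0..<t}"] by simp
    qed
    ultimately show ?thesis
      by (simp cong: measurable_cong)
  qed
  then have "(\<lambda>\<omega>. ennreal (measure (\<nu> \<omega>) {t..T})) \<in> borel_measurable M"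
    by simp
  moreover have "emeasure (\<nu> \<omega>) {t..T} = ennreal (measure (\<nu> \<omega>) {t..T})" if "\<omega> \<in> space M" for \<omega>
  proof -
    interpret interval_measure "\<nu> \<omega>" T
      by (rule interval_measure_adapted[OF assms(1) that])
    show ?thesis
      by (rule emeasure_eq_measure)
  qed
  ultimately show ?thesis
    by (simp cong: measurable_cong)
qed

text \<open>A weight known at time \<open>t\<close> may be multiplied by the conditional expectation
  of the tail instead of the tail itself, and that expectation is almost everywhere at most the BMO
  norm.\<close>

lemma nn_integral_mult_tail_le:
  assumes \<nu>: "adapted_random_measure M F T \<nu>" and t: "t \<in> {0..T}"
    and f: "f \<in> borel_measurable (F t)"
  shows "(\<integral>\<^sup>+\<omega>. f \<omega> * emeasure (\<nu> \<omega>) {t..T} \<partial>M) \<le> bmo_norm M F T \<nu> * (\<integral>\<^sup>+\<omega>. f \<omega> \<partial>M)"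
proof -
  define h where "h = nn_cond_exp M (F t) (\<lambda>\<omega>. emeasure (\<nu> \<omega>) {t..T})"
  interpret finite_measure_subalgebra M "F t"
    by standard (rule subalgebra_F[OF t])
  note [measurable] = measurable_emeasure_tail[OF \<nu> t] f measurable_F_M[OF f t]
  have "(\<integral>\<^sup>+\<omega>. f \<omega> * emeasure (\<nu> \<omega>) {t..T} \<partial>M) = (\<integral>\<^sup>+\<omega>. f \<omega> * h \<omega> \<partial>M)"
    unfolding h_def by (rule nn_cond_exp_intg[symmetric]) measurable
  also have "\<dots> \<le> (\<integral>\<^sup>+\<omega>. bmo_norm M F T \<nu> * f \<omega> \<partial>M)"
  proof (rule nn_integral_mono_AE)
    have le: "esssup M h \<le> bmo_norm M F T \<nu>"
      unfolding h_def bmo_norm_def using t by (intro SUP_upper)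
    show "AE \<omega> in M. f \<omega> * h \<omega> \<le> bmo_norm M F T \<nu> * f \<omega>"
      using esssup_AE[of h M]
    proof eventually_elim
      case (elim \<omega>)
      then have "h \<omega> \<le> bmo_norm M F T \<nu>"
        using le by (rule order_trans)
      then show ?case
        by (subst mult.commute) (rule mult_right_mono, auto)
    qed
  qed
  also have "\<dots> = bmo_norm M F T \<nu> * (\<integral>\<^sup>+\<omega>. f \<omega> \<partial>M)"
    by (intro nn_integral_cmult) measurable
  finally show ?thesis .
qed

text \<open>After summation by parts, the nonnegative increment \<open>y (Suc k) - y k\<close> is
  known at time \<open>P (Suc k)\<close> and multiplies the mass after that time. Conditioning there
  gives one factor of the BMO norm per term, and the increments telescope to
  \<open>y n\<close>.\<close>

lemma nn_integral_stieltjes_sum_le_bmo: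
  fixes y :: "nat \<Rightarrow> 'a \<Rightarrow> real"
  assumes \<nu>: "adapted_random_measure M F T \<nu>"
    and P: "P 0 = 0" "P (Suc n) = T" "\<And>k. k \<le> n \<Longrightarrow> P k \<in> {0..T}" "mono P"
    and y: "\<And>k. k \<le> n \<Longrightarrow> y k \<in> borel_measurable (F (P k))"
    and y0: "\<And>\<omega>. \<omega> \<in> space M \<Longrightarrow> 0 \<le> y 0 \<omega>"
    and y_mono: "\<And>k \<omega>. \<omega> \<in> space M \<Longrightarrow> k < n \<Longrightarrow> y k \<omega> \<le> y (Suc k) \<omega>"
  shows "(\<integral>\<^sup>+\<omega>. ennreal (y 0 \<omega> * measure (\<nu> \<omega>) {0..0} +
      (\<Sum>k<Suc n. y k \<omega> * (measure (\<nu> \<omega>) {0..P (Suc k)} - measure (\<nu> \<omega>) {0..P k}))) \<partial>M)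
    \<le> bmo_norm M F T \<nu> * (\<integral>\<^sup>+\<omega>. ennreal (y n \<omega>) \<partial>M)"
proof -
  define B where "B = bmo_norm M F T \<nu>"
  define R where "R k \<omega> = emeasure (\<nu> \<omega>) {P k..T}" for k \<omega>
  have [measurable]: "y k \<in> borel_measurable M" "R k \<in> borel_measurable M" if "k \<le> n" for k
    using that y[OF that] P(3) \<nu> unfolding R_def
    by (auto intro: measurable_F_M measurable_emeasure_tail)
  have step: "(\<integral>\<^sup>+\<omega>. ennreal (y (Suc k) \<omega> - y k \<omega>) * R (Suc k) \<omega> \<partial>M)
      \<le> B * (\<integral>\<^sup>+\<omega>. ennreal (y (Suc k) \<omega> - y k \<omega>) \<partial>M)" if "k < n" for k
  proof -
    have "y k \<in> borel_measurable (F (P (Suc k)))"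
      using that P(3)[of k] P(3)[of "Suc k"] monoD[OF P(4), of k "Suc k"]
      by (intro measurable_F_mono[OF y]) auto
    moreover have "y (Suc k) \<in> borel_measurable (F (P (Suc k)))"
      using that by (intro y) auto
    ultimately have "(\<lambda>\<omega>. ennreal (y (Suc k) \<omega> - y k \<omega>)) \<in> borel_measurable (F (P (Suc k)))"
      by simp
    then show ?thesis
      unfolding R_def B_def using that P(3) by (intro nn_integral_mult_tail_le \<nu>) auto
  qed
  have "(\<integral>\<^sup>+\<omega>. ennreal (y 0 \<omega> * measure (\<nu> \<omega>) {0..0} +
      (\<Sum>k<Suc n. y k \<omega> * (measure (\<nu> \<omega>) {0..P (Suc k)} - measure (\<nu> \<omega>) {0..P k}))) \<partial>M)
    \<le> (\<integral>\<^sup>+\<omega>. ennreal (y 0 \<omega>) * R 0 \<omega> + (\<Sum>k<n. ennreal (y (Suc k) \<omega> - y k \<omega>) * R (Suc k) \<omega>) \<partial>M)"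
  proof (rule nn_integral_mono)
    fix \<omega> assume \<omega>: "\<omega> \<in> space M"
    interpret interval_measure "\<nu> \<omega>" T
      by (rule interval_measure_adapted[OF \<nu> \<omega>])
    define g where "g k = measure (\<nu> \<omega>) {0..P k}" for k
    have R: "R k \<omega> = ennreal (measure (\<nu> \<omega>) {P k..T})" for k
      by (simp add: R_def emeasure_eq_measure)
    \<comment> \<open>Increments only see the left-open tail, whereas the BMO norm is defined with
      closed tails; enlarging the interval goes in the right direction.\<close>
    have g_le: "g (Suc n) - g k \<le> measure (\<nu> \<omega>) {P k..T}" if "k \<le> n" for k
    proof -
      have "g (Suc n) - g k = measure (\<nu> \<omega>) {P k<..T}"
        using P(2) P(3)[OF that] by (simp add: g_def measure_Ioc)
      also have "\<dots> \<le> measure (\<nu> \<omega>) {P k..T}"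
        using P(3)[OF that] by (intro finite_measure_mono borel_in_sets) auto
      finally show ?thesis .
    qed
    have "y 0 \<omega> * measure (\<nu> \<omega>) {0..0} +
        (\<Sum>k<Suc n. y k \<omega> * (measure (\<nu> \<omega>) {0..P (Suc k)} - measure (\<nu> \<omega>) {0..P k})) =
        y 0 \<omega> * g 0 + (\<Sum>k<Suc n. y k \<omega> * (g (Suc k) - g k))"
      by (simp only: g_def P(1))
    also have "\<dots> = y 0 \<omega> * g (Suc n) + (\<Sum>k<n. (y (Suc k) \<omega> - y k \<omega>) * (g (Suc n) - g (Suc k)))"
      by (rule summation_by_parts)
    also have "\<dots> \<le> y 0 \<omega> * measure (\<nu> \<omega>) {P 0..T} +
        (\<Sum>k<n. (y (Suc k) \<omega> - y k \<omega>) * measure (\<nu> \<omega>) {P (Suc k)..T})"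
      using \<omega> y0 y_mono g_le
      by (intro add_mono sum_mono mult_left_mono) (auto simp: g_def P)
    finally have "ennreal (y 0 \<omega> * measure (\<nu> \<omega>) {0..0} +
        (\<Sum>k<Suc n. y k \<omega> * (measure (\<nu> \<omega>) {0..P (Suc k)} - measure (\<nu> \<omega>) {0..P k}))) \<le>
        ennreal (y 0 \<omega> * measure (\<nu> \<omega>) {P 0..T} +
        (\<Sum>k<n. (y (Suc k) \<omega> - y k \<omega>) * measure (\<nu> \<omega>) {P (Suc k)..T}))"
      by (rule ennreal_leI)
    also have "\<dots> = ennreal (y 0 \<omega>) * R 0 \<omega> + (\<Sum>k<n. ennreal (y (Suc k) \<omega> - y k \<omega>) * R (Suc k) \<omega>)"
    proof -
      have "ennreal (\<Sum>k<n. (y (Suc k) \<omega> - y k \<omega>) * measure (\<nu> \<omega>) {P (Suc k)..T}) =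
          (\<Sum>k<n. ennreal (y (Suc k) \<omega> - y k \<omega>) * R (Suc k) \<omega>)"
        using y_mono[OF \<omega>] by (subst sum_ennreal[symmetric]) (auto simp: R ennreal_mult)
      moreover have "0 \<le> (\<Sum>k<n. (y (Suc k) \<omega> - y k \<omega>) * measure (\<nu> \<omega>) {P (Suc k)..T})"
        using y_mono[OF \<omega>] by (intro sum_nonneg) auto
      ultimately show ?thesis
        using y0[OF \<omega>] by (simp add: R ennreal_plus ennreal_mult)
    qed
    finally show "ennreal (y 0 \<omega> * measure (\<nu> \<omega>) {0..0} +
        (\<Sum>k<Suc n. y k \<omega> * (measure (\<nu> \<omega>) {0..P (Suc k)} - measure (\<nu> \<omega>) {0..P k}))) \<le>
        ennreal (y 0 \<omega>) * R 0 \<omega> + (\<Sum>k<n. ennreal (y (Suc k) \<omega> - y k \<omega>) * R (Suc k) \<omega>)" .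
  qed
  also have "\<dots> = (\<integral>\<^sup>+\<omega>. ennreal (y 0 \<omega>) * R 0 \<omega> \<partial>M) +
      (\<Sum>k<n. \<integral>\<^sup>+\<omega>. ennreal (y (Suc k) \<omega> - y k \<omega>) * R (Suc k) \<omega> \<partial>M)"
    by (subst nn_integral_add nn_integral_sum; simp)+
  also have "\<dots> \<le> B * (\<integral>\<^sup>+\<omega>. ennreal (y 0 \<omega>) \<partial>M) +
      (\<Sum>k<n. B * (\<integral>\<^sup>+\<omega>. ennreal (y (Suc k) \<omega> - y k \<omega>) \<partial>M))"
  proof (intro add_mono sum_mono step)
    show "(\<integral>\<^sup>+\<omega>. ennreal (y 0 \<omega>) * R 0 \<omega> \<partial>M) \<le> B * (\<integral>\<^sup>+\<omega>. ennreal (y 0 \<omega>) \<partial>M)"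
      unfolding R_def B_def using P(3)[of 0] y[of 0] by (intro nn_integral_mult_tail_le \<nu>) auto
  qed simp
  \<comment> \<open>The increments are collected under one integral before telescoping, where they
    are still real numbers, so no subtraction of possibly infinite expectations occurs.\<close>
  also have "\<dots> = B * (\<integral>\<^sup>+\<omega>. ennreal (y 0 \<omega>) + (\<Sum>k<n. ennreal (y (Suc k) \<omega> - y k \<omega>)) \<partial>M)"
  proof -
    have "(\<integral>\<^sup>+\<omega>. ennreal (y 0 \<omega>) + (\<Sum>k<n. ennreal (y (Suc k) \<omega> - y k \<omega>)) \<partial>M) =
        (\<integral>\<^sup>+\<omega>. ennreal (y 0 \<omega>) \<partial>M) + (\<Sum>k<n. \<integral>\<^sup>+\<omega>. ennreal (y (Suc k) \<omega> - y k \<omega>) \<partial>M)"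
      by (subst nn_integral_add nn_integral_sum; simp)+
    then show ?thesis
      by (simp add: distrib_left sum_distrib_left)
  qed
  also have "(\<integral>\<^sup>+\<omega>. ennreal (y 0 \<omega>) + (\<Sum>k<n. ennreal (y (Suc k) \<omega> - y k \<omega>)) \<partial>M) =
      (\<integral>\<^sup>+\<omega>. ennreal (y n \<omega>) \<partial>M)"
  proof (rule nn_integral_cong)
    fix \<omega> assume \<omega>: "\<omega> \<in> space M"
    have "ennreal (y 0 \<omega>) + (\<Sum>k<n. ennreal (y (Suc k) \<omega> - y k \<omega>)) =
        ennreal (y 0 \<omega> + (\<Sum>k<n. y (Suc k) \<omega> - y k \<omega>))"
    proof -
      have "(\<Sum>k<n. ennreal (y (Suc k) \<omega> - y k \<omega>)) = ennreal (\<Sum>k<n. y (Suc k) \<omega> - y k \<omega>)"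
        using y_mono[OF \<omega>] by (intro sum_ennreal) auto
      moreover have "0 \<le> (\<Sum>k<n. y (Suc k) \<omega> - y k \<omega>)"
        using y_mono[OF \<omega>] by (intro sum_nonneg) auto
      ultimately show ?thesis
        using y0[OF \<omega>] by (simp only: ennreal_plus)
    qed
    also have "(\<Sum>k<n. y (Suc k) \<omega> - y k \<omega>) = y n \<omega> - y 0 \<omega>"
      by (rule sum_lessThan_telescope)
    finally show "ennreal (y 0 \<omega>) + (\<Sum>k<n. ennreal (y (Suc k) \<omega> - y k \<omega>)) = ennreal (y n \<omega>)"
      by simp
  qed
  finally show ?thesis
    by (simp add: B_def)
qed

end

section \<open>Pathwise bound for the first factor\<close>

text \<open>With right endpoints as tags, each summand is at most twice an increment of the square
  root of the distribution function, so the sums telescope. The atom at 0 keeps the distribution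
  function positive; hence the integrand is continuous and the sums converge.\<close>

lemma (in interval_measure) integral_inverse_sqrt_le:
  assumes cont: "continuous_on {0..T} (\<lambda>t. measure \<kappa> {0..t})" and pos: "0 < measure \<kappa> {0}"
  shows "(\<integral>t. measure \<kappa> {0..t} powr (-1/2) \<partial>\<kappa>) \<le> 2 * measure \<kappa> {0..T} powr (1/2)"
proof -
  define g where "g = (\<lambda>t. measure \<kappa> {0..t})"
  have g_mono: "g s \<le> g t" if "s \<le> t" "t \<le> T" for s t
    unfolding g_def using that by (intro finite_measure_mono borel_in_sets) auto
  have g_pos: "0 < g t" if "0 \<le> t" "t \<le> T" for t
    using pos g_mono[OF that] by (simp add: g_def)
  \<comment> \<open>Factor \<open>b - a\<close> as a difference of squares and bound
    \<open>sqrt b + sqrt a\<close> by \<open>2 * sqrt b\<close>; this is the origin of the constant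
    2.\<close>
  have sqrt_step: "b powr (-1/2) * (b - a) \<le> 2 * (sqrt b - sqrt a)" if "0 < a" "a \<le> b" for a b :: real
  proof -
    have "b powr (-1/2) = 1 / sqrt b"
      using that by (simp add: powr_minus_divide powr_half_sqrt)
    moreover have "b - a = (sqrt b - sqrt a) * (sqrt b + sqrt a)"
      using that by (simp add: algebra_simps)
    moreover have "(sqrt b - sqrt a) * (sqrt b + sqrt a) \<le> (sqrt b - sqrt a) * (2 * sqrt b)"
      using that by (intro mult_left_mono) auto
    ultimately show ?thesis
      using that by (simp add: pos_divide_le_eq mult_ac)
  qed
  have sum_le: "stieltjes_sum (\<lambda>t. g t powr (-1/2)) g (\<lambda>k. grid T n (Suc k)) (grid T n) k
      \<le> 2 * sqrt (g (grid T n k))" if "k \<le> Suc n" for n k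
    using that
  proof (induction k)
    case 0
    have "g 0 powr (-1/2) * g 0 = sqrt (g 0)"
      using g_pos[of 0] T_pos by (simp add: powr_minus_divide powr_half_sqrt real_div_sqrt)
    then show ?case
      using g_pos[of 0] T_pos by simp
  next
    case (Suc k)
    have "g (grid T n (Suc k)) powr (-1/2) * (g (grid T n (Suc k)) - g (grid T n k)) \<le>
        2 * (sqrt (g (grid T n (Suc k))) - sqrt (g (grid T n k)))"
      using Suc.prems T_pos monoD[OF mono_grid[OF T_pos, of n], of k "Suc k"]
      by (intro sqrt_step g_pos g_mono) (auto simp: grid_bounds)
    then show ?case
      using Suc by simp
  qed
  have "(\<lambda>n. stieltjes_sum (\<lambda>t. g t powr (-1/2)) g (\<lambda>k. grid T n (Suc k)) (grid T n) (Suc n))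
      \<longlonglongrightarrow> (\<integral>t. g t powr (-1/2) \<partial>\<kappa>)"
    unfolding g_def
  proof (rule stieltjes_sum_tendsto)
    have "g t \<noteq> 0" if "t \<in> {0..T}" for t
      using g_pos[of t] that by auto
    then show "continuous_on {0..T} (\<lambda>t. measure \<kappa> {0..t} powr (-1/2))"
      using cont by (intro continuous_intros) (auto simp: g_def)
    show "grid T n (Suc k) \<in> {grid T n k..grid T n (Suc k)}" for n k
      using monoD[OF mono_grid[OF T_pos, of n], of k "Suc k"] by simp
  qed
  then have "(\<integral>t. g t powr (-1/2) \<partial>\<kappa>) \<le> 2 * sqrt (g T)"
    using sum_le[of "Suc n" n for n] by (intro LIMSEQ_le_const2) auto
  then show ?thesis
    by (simp add: g_def powr_half_sqrt)
qed

section \<open>Hoelder's inequality with explicit constants\<close>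

text \<open>Young's inequality is applied to \<open>W\<close> and \<open>X\<close> divided by their
  p-norms \<open>c\<close> and \<open>a\<close>, and then integrated.\<close>

lemma nn_integral_powr_mult_le:
  fixes X W :: "'a \<Rightarrow> real"
  assumes p: "1 < p"
    and [measurable]: "X \<in> borel_measurable M" "W \<in> borel_measurable M"
    and nonneg: "\<And>\<omega>. \<omega> \<in> space M \<Longrightarrow> 0 \<le> X \<omega>" "\<And>\<omega>. \<omega> \<in> space M \<Longrightarrow> 0 \<le> W \<omega>"
    and A: "(\<integral>\<^sup>+\<omega>. ennreal (X \<omega> powr p) \<partial>M) = ennreal A" "0 < A"
    and C: "(\<integral>\<^sup>+\<omega>. ennreal (W \<omega> powr p) \<partial>M) = ennreal C" "0 < C"
  shows "(\<integral>\<^sup>+\<omega>. ennreal (X \<omega> powr (p - 1) * W \<omega>) \<partial>M)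
    \<le> ennreal (A powr ((p - 1) / p) * C powr (1 / p))"
proof -
  define a c where "a = A powr (1 / p)" and "c = C powr (1 / p)"
  have ac: "0 < a" "0 < c" "a powr p = A" "c powr p = C" "a powr (p - 1) = A powr ((p - 1) / p)"
    using p A C by (simp_all add: a_def c_def powr_powr)
  define q where "q = p / (p - 1)"
  have q: "1 < q" "1 / p + 1 / q = 1" "(p - 1) * q = p" "1 / q = (p - 1) / p"
    using p by (simp_all add: q_def field_simps)
  \<comment> \<open>The bound aimed at; multiplying by it undoes the normalisation, and the weights
    \<open>1 / p\<close> and \<open>1 / q\<close> then add up to 1.\<close>
  define K where "K = a powr (p - 1) * c"
  have K: "0 < K"
    using ac(1,2) by (simp add: K_def)
  have young: "X \<omega> powr (p - 1) * W \<omega> \<le>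
      K / (p * C) * W \<omega> powr p + K / (q * A) * X \<omega> powr p" if "\<omega> \<in> space M" for \<omega>
  proof -
    have "W \<omega> / c * (X \<omega> / a) powr (p - 1) \<le>
        (W \<omega> / c) powr p / p + ((X \<omega> / a) powr (p - 1)) powr q / q"
      using p q ac nonneg[OF that] by (intro Youngs_inequality) auto
    also have "\<dots> = W \<omega> powr p / (p * C) + X \<omega> powr p / (q * A)"
      using p q ac A(2) nonneg[OF that] by (simp add: powr_powr powr_divide mult.commute)
    finally have "K * (W \<omega> / c * (X \<omega> / a) powr (p - 1)) \<le>
        K * (W \<omega> powr p / (p * C) + X \<omega> powr p / (q * A))"
      using K by (intro mult_left_mono) auto
    moreover have "K * (W \<omega> / c * (X \<omega> / a) powr (p - 1)) = X \<omega> powr (p - 1) * W \<omega>"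
      using ac A(2) nonneg[OF that] by (simp add: K_def powr_divide)
    ultimately show ?thesis
      by (simp add: distrib_left)
  qed
  have "(\<integral>\<^sup>+\<omega>. ennreal (X \<omega> powr (p - 1) * W \<omega>) \<partial>M) \<le>
      (\<integral>\<^sup>+\<omega>. ennreal (K / (p * C)) * ennreal (W \<omega> powr p) +
        ennreal (K / (q * A)) * ennreal (X \<omega> powr p) \<partial>M)"
    using young p q A C K
    by (intro nn_integral_mono)
      (simp add: ennreal_mult[symmetric] ennreal_plus[symmetric] ennreal_leI del: ennreal_plus)
  also have "\<dots> = ennreal (K / (p * C)) * ennreal C + ennreal (K / (q * A)) * ennreal A"
    by (simp add: nn_integral_add nn_integral_cmult A C)
  also have "\<dots> = ennreal (K / (p * C) * C + K / (q * A) * A)"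
    using p q A C K by (simp add: ennreal_mult[symmetric] ennreal_plus[symmetric] del: ennreal_plus)
  also have "K / (p * C) * C + K / (q * A) * A = K * (1 / p + 1 / q)"
    using A C by (simp add: distrib_left)
  also have "\<dots> = A powr ((p - 1) / p) * C powr (1 / p)"
    using q ac by (simp add: K_def c_def)
  finally show ?thesis .
qed

section \<open>Power estimates for adapted, continuous, nondecreasing integrands\<close>

context stochastic_basis
begin

context
  fixes \<nu> :: "'a \<Rightarrow> real measure" and w :: "'a \<Rightarrow> real \<Rightarrow> real"
  assumes \<nu>: "adapted_random_measure M F T \<nu>"
    and w_meas: "\<And>t. t \<in> {0..T} \<Longrightarrow> (\<lambda>\<omega>. w \<omega> t) \<in> borel_measurable (F t)"
    and w_cont: "\<And>\<omega>. \<omega> \<in> space M \<Longrightarrow> continuous_on {0..T} (w \<omega>)"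
    and w_mono: "\<And>\<omega>. \<omega> \<in> space M \<Longrightarrow> mono_on {0..T} (w \<omega>)"
    and w_nonneg: "\<And>\<omega>. \<omega> \<in> space M \<Longrightarrow> 0 \<le> w \<omega> 0"
begin

lemma measurable_stieltjes_sum:
  assumes "k \<le> Suc n"
  shows "(\<lambda>\<omega>. stieltjes_sum (w \<omega>) (\<lambda>t. measure (\<nu> \<omega>) {0..t}) (grid T n) (grid T n) k)
    \<in> borel_measurable (F (grid T n k))"
proof -
  have grid: "0 \<le> grid T n j" "grid T n j \<le> grid T n k" "grid T n k \<le> T" if "j \<le> k" for j
    using that assms T_pos monoD[OF mono_grid[OF T_pos, of n], of j k] by (auto simp: grid_bounds)
  have [measurable]: "(\<lambda>\<omega>. w \<omega> (grid T n j)) \<in> borel_measurable (F (grid T n k))"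
    "(\<lambda>\<omega>. measure (\<nu> \<omega>) {0..grid T n j}) \<in> borel_measurable (F (grid T n k))" if "j \<le> k" for j
    using grid[OF that]
    by (auto intro!: measurable_F_mono[OF w_meas] measurable_F_mono[OF adapted_measurable_F[OF \<nu>]])
  have "(\<lambda>\<omega>. w \<omega> (grid T n 0) * measure (\<nu> \<omega>) {0..grid T n 0} +
      (\<Sum>j<k. w \<omega> (grid T n j) *
        (measure (\<nu> \<omega>) {0..grid T n (Suc j)} - measure (\<nu> \<omega>) {0..grid T n j})))
      \<in> borel_measurable (F (grid T n k))"
    by measurable
  then show ?thesis
    by (simp add: stieltjes_sum_def)
qed

text \<open>The integrating measure itself varies with \<open>\<omega>\<close>, so measurability is
  obtained from the pathwise limit of the Riemann--Stieltjes sums.\<close>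

lemma measurable_pathwise_integral: "(\<lambda>\<omega>. \<integral>t. w \<omega> t \<partial>\<nu> \<omega>) \<in> borel_measurable M"
proof (rule borel_measurable_LIMSEQ_real)
  show "(\<lambda>n. stieltjes_sum (w \<omega>) (\<lambda>t. measure (\<nu> \<omega>) {0..t}) (grid T n) (grid T n) (Suc n))
      \<longlonglongrightarrow> (\<integral>t. w \<omega> t \<partial>\<nu> \<omega>)" if "\<omega> \<in> space M" for \<omega>
  proof -
    interpret interval_measure "\<nu> \<omega>" T
      by (rule interval_measure_adapted[OF \<nu> that])
    show ?thesis
      using monoD[OF mono_grid[OF T_pos]]
      by (intro stieltjes_sum_tendsto w_cont that) auto
  qed
  show "(\<lambda>\<omega>. stieltjes_sum (w \<omega>) (\<lambda>t. measure (\<nu> \<omega>) {0..t}) (grid T n) (grid T n) (Suc n))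
      \<in> borel_measurable M" for n
    using T_pos measurable_stieltjes_sum[of "Suc n" n] by (intro measurable_F_M[where t=T]) auto
qed

text \<open>The left-endpoint weights form an adapted nondecreasing sequence \<open>y\<close>, so
  the BMO estimate applies. Its last member is dominated by the weight at time \<open>T\<close>,
  uniformly in \<open>n\<close>.\<close>

lemma nn_integral_powr_stieltjes_sum_le:
  assumes p: "1 < p"
  shows "(\<integral>\<^sup>+\<omega>. ennreal (powr_stieltjes_sum p (w \<omega>) (\<lambda>t. measure (\<nu> \<omega>) {0..t}) (grid T n) (Suc n)) \<partial>M)
    \<le> bmo_norm M F T \<nu> * (\<integral>\<^sup>+\<omega>. ennreal ((\<integral>t. w \<omega> t \<partial>\<nu> \<omega>) powr (p - 1) * w \<omega> T) \<partial>M)"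
proof -
  define S where
    "S k \<omega> = stieltjes_sum (w \<omega>) (\<lambda>t. measure (\<nu> \<omega>) {0..t}) (grid T n) (grid T n) k" for k \<omega>
  define y where "y k \<omega> = S k \<omega> powr (p - 1) * w \<omega> (grid T n k)" for k \<omega>
  have grid_in: "grid T n k \<in> {0..T}" if "k \<le> Suc n" for k
    using that T_pos by (simp add: grid_bounds)
  have grid_le: "grid T n k \<le> grid T n (Suc k)" for k
    using monoD[OF mono_grid[OF T_pos]] by simp
  have w_pos: "0 \<le> w \<omega> t" if "\<omega> \<in> space M" "t \<in> {0..T}" for \<omega> t
    using that w_nonneg[OF that(1)] mono_onD[OF w_mono[OF that(1)], of 0 t] by auto
  have S_step: "S k \<omega> \<le> S (Suc k) \<omega>" if "\<omega> \<in> space M" "k < Suc n" for k \<omega>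
  proof -
    interpret interval_measure "\<nu> \<omega>" T
      by (rule interval_measure_adapted[OF \<nu> that(1)])
    have "measure (\<nu> \<omega>) {0..grid T n k} \<le> measure (\<nu> \<omega>) {0..grid T n (Suc k)}"
      using that grid_in[of "Suc k"] grid_le[of k] by (intro finite_measure_mono borel_in_sets) auto
    then show ?thesis
      using that w_pos[OF that(1) grid_in[of k]] by (simp add: S_def)
  qed
  have S_nonneg: "0 \<le> S k \<omega>" if "\<omega> \<in> space M" "k \<le> Suc n" for k \<omega>
    using that(2)
  proof (induction k)
    case 0
    then show ?case using w_nonneg[OF that(1)] by (simp add: S_def)
  next
    case (Suc k)
    then show ?case using S_step[OF that(1), of k] by simp
  qed
  have "(\<integral>\<^sup>+\<omega>. ennreal (y 0 \<omega> * measure (\<nu> \<omega>) {0..0} + (\<Sum>k<Suc n. y k \<omega> *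
      (measure (\<nu> \<omega>) {0..grid T n (Suc k)} - measure (\<nu> \<omega>) {0..grid T n k}))) \<partial>M)
    \<le> bmo_norm M F T \<nu> * (\<integral>\<^sup>+\<omega>. ennreal (y n \<omega>) \<partial>M)"
  proof (rule nn_integral_stieltjes_sum_le_bmo[OF \<nu>])
    show "y k \<in> borel_measurable (F (grid T n k))" if "k \<le> n" for k
      using measurable_stieltjes_sum[of k n] w_meas[OF grid_in, of k] that
      by (simp add: y_def[abs_def] S_def)
    show "0 \<le> y 0 \<omega>" if "\<omega> \<in> space M" for \<omega>
      using w_nonneg[OF that] by (simp add: y_def)
    show "y k \<omega> \<le> y (Suc k) \<omega>" if "\<omega> \<in> space M" "k < n" for k \<omega>
      unfolding y_def
    proof (rule mult_mono)
      show "S k \<omega> powr (p - 1) \<le> S (Suc k) \<omega> powr (p - 1)"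
        using that p S_step[of \<omega> k] S_nonneg[of \<omega> k] by (intro powr_mono2) auto
      show "w \<omega> (grid T n k) \<le> w \<omega> (grid T n (Suc k))"
        using that grid_in[of k] grid_in[of "Suc k"] grid_le by (intro mono_onD[OF w_mono]) auto
      show "0 \<le> w \<omega> (grid T n k)"
        using that by (intro w_pos grid_in) auto
    qed simp
  qed (use grid_in mono_grid[OF T_pos] in auto)
  also have "\<dots> \<le> bmo_norm M F T \<nu> * (\<integral>\<^sup>+\<omega>. ennreal ((\<integral>t. w \<omega> t \<partial>\<nu> \<omega>) powr (p - 1) * w \<omega> T) \<partial>M)"
  proof (intro mult_left_mono nn_integral_mono ennreal_leI)
    fix \<omega> assume \<omega>: "\<omega> \<in> space M"
    interpret interval_measure "\<nu> \<omega>" T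
      by (rule interval_measure_adapted[OF \<nu> \<omega>])
    \<comment> \<open>The comparison with the integral is available only for the full sum, hence one
      more summand is added first.\<close>
    have "S n \<omega> \<le> S (Suc n) \<omega>"
      using \<omega> by (intro S_step) auto
    also have "\<dots> \<le> (\<integral>t. w \<omega> t \<partial>\<nu> \<omega>)"
      unfolding S_def using \<omega> by (intro stieltjes_sum_le_integral mono_grid T_pos w_cont w_mono) auto
    finally have "S n \<omega> powr (p - 1) \<le> (\<integral>t. w \<omega> t \<partial>\<nu> \<omega>) powr (p - 1)"
      using p S_nonneg[OF \<omega>, of n] by (intro powr_mono2) auto
    moreover have "w \<omega> (grid T n n) \<le> w \<omega> T"
      using grid_in[of n] T_pos by (intro mono_onD[OF w_mono[OF \<omega>]]) auto
    ultimately show "y n \<omega> \<le> (\<integral>t. w \<omega> t \<partial>\<nu> \<omega>) powr (p - 1) * w \<omega> T"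
      unfolding y_def using w_pos[OF \<omega> grid_in[of n]] by (intro mult_mono) auto
  qed simp
  finally show ?thesis
    by (simp add: powr_stieltjes_sum_def y_def S_def)
qed

text \<open>Fatou's lemma applied to the pathwise chain rule; the expectations on the grids have a
  bound independent of \<open>n\<close>.\<close>

lemma nn_integral_pathwise_integral_powr_le:
  assumes p: "1 < p" and \<nu>_cont: "continuous_paths M T \<nu>"
  shows "(\<integral>\<^sup>+\<omega>. ennreal ((\<integral>t. w \<omega> t \<partial>\<nu> \<omega>) powr p) \<partial>M)
    \<le> ennreal p * (bmo_norm M F T \<nu> *
        (\<integral>\<^sup>+\<omega>. ennreal ((\<integral>t. w \<omega> t \<partial>\<nu> \<omega>) powr (p - 1) * w \<omega> T) \<partial>M))"
    (is "_ \<le> ?R")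
proof -
  define Z where
    "Z n \<omega> = powr_stieltjes_sum p (w \<omega>) (\<lambda>t. measure (\<nu> \<omega>) {0..t}) (grid T n) (Suc n)" for n \<omega>
  have Z_meas [measurable]: "Z n \<in> borel_measurable M" for n
  proof -
    have grid_in: "grid T n k \<in> {0..T}" if "k \<le> Suc n" for k
      using that T_pos by (simp add: grid_bounds)
    have [measurable]: "(\<lambda>\<omega>. w \<omega> (grid T n k)) \<in> borel_measurable M"
      "(\<lambda>\<omega>. measure (\<nu> \<omega>) {0..grid T n k}) \<in> borel_measurable M"
      "(\<lambda>\<omega>. stieltjes_sum (w \<omega>) (\<lambda>t. measure (\<nu> \<omega>) {0..t}) (grid T n) (grid T n) k)
        \<in> borel_measurable M" if "k \<le> Suc n" for k
      using grid_in[OF that] that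
      by (auto intro: measurable_F_M[OF w_meas] adapted_measurable_M[OF \<nu>]
          measurable_F_M[OF measurable_stieltjes_sum])
    have "(\<lambda>\<omega>. (stieltjes_sum (w \<omega>) (\<lambda>t. measure (\<nu> \<omega>) {0..t}) (grid T n) (grid T n) 0 powr (p - 1)
          * w \<omega> (grid T n 0)) * measure (\<nu> \<omega>) {0..grid T n 0} +
        (\<Sum>k<Suc n. (stieltjes_sum (w \<omega>) (\<lambda>t. measure (\<nu> \<omega>) {0..t}) (grid T n) (grid T n) k powr (p - 1)
          * w \<omega> (grid T n k)) *
          (measure (\<nu> \<omega>) {0..grid T n (Suc k)} - measure (\<nu> \<omega>) {0..grid T n k})))
        \<in> borel_measurable M"
      by measurable
    then show ?thesis
      by (simp add: Z_def[abs_def] powr_stieltjes_sum_def)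
  qed
  have "(\<integral>\<^sup>+\<omega>. ennreal ((\<integral>t. w \<omega> t \<partial>\<nu> \<omega>) powr p) \<partial>M) \<le>
      (\<integral>\<^sup>+\<omega>. liminf (\<lambda>n. ennreal (p * Z n \<omega>)) \<partial>M)"
  proof (rule nn_integral_mono)
    fix \<omega> assume \<omega>: "\<omega> \<in> space M"
    interpret interval_measure "\<nu> \<omega>" T
      by (rule interval_measure_adapted[OF \<nu> \<omega>])
    show "ennreal ((\<integral>t. w \<omega> t \<partial>\<nu> \<omega>) powr p) \<le> liminf (\<lambda>n. ennreal (p * Z n \<omega>))"
      unfolding Z_def using \<omega> \<nu>_cont
      by (intro powr_integral_le_liminf p w_cont w_mono w_nonneg) (auto simp: continuous_paths_def)
  qed
  also have "\<dots> \<le> liminf (\<lambda>n. \<integral>\<^sup>+\<omega>. ennreal (p * Z n \<omega>) \<partial>M)"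
    by (rule nn_integral_liminf) measurable
  also have "\<dots> \<le> liminf (\<lambda>n. ?R)"
  proof (intro Liminf_mono always_eventually allI)
    fix n
    have "(\<integral>\<^sup>+\<omega>. ennreal (p * Z n \<omega>) \<partial>M) = ennreal p * (\<integral>\<^sup>+\<omega>. ennreal (Z n \<omega>) \<partial>M)"
      using p by (subst nn_integral_cmult[symmetric]) (auto simp: ennreal_mult')
    also have "\<dots> \<le> ?R"
      unfolding Z_def by (intro mult_left_mono nn_integral_powr_stieltjes_sum_le p) auto
    finally show "(\<integral>\<^sup>+\<omega>. ennreal (p * Z n \<omega>) \<partial>M) \<le> ?R" .
  qed
  also have "\<dots> = ?R"
    by (simp add: Liminf_const)
  finally show ?thesis .
qed

end

end

section \<open>Norms and the conclusion\<close>

lemma Lq_norm_finite: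
  assumes "(\<integral>\<^sup>+\<omega>. ennreal (\<bar>X \<omega>\<bar> powr q) \<partial>M) = ennreal I" "0 \<le> I"
  shows "Lq_norm M q X = ennreal (I powr (1 / q))"
  using assms by (simp add: Lq_norm_def)

lemma Lq_norm_infinite:
  "(\<integral>\<^sup>+\<omega>. ennreal (\<bar>X \<omega>\<bar> powr q) \<partial>M) = \<infinity> \<Longrightarrow> Lq_norm M q X = \<infinity>"
  by (simp add: Lq_norm_def)

theorem theorem5p18:
  fixes M :: "'a measure" and F :: "real \<Rightarrow> 'a measure" and T p :: real
    and \<mu> \<nu> :: "'a \<Rightarrow> real measure"
  assumes "stochastic_basis M F T"
    and "adapted_random_measure M F T \<mu>" and "adapted_random_measure M F T \<nu>"
    and "continuous_paths M T \<mu>" and "continuous_paths M T \<nu>"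
    and "\<And>\<omega>. \<omega> \<in> space M \<Longrightarrow> measure (\<mu> \<omega>) {0} > 0"
    and "1 < p"
    and "(\<integral>\<^sup>+\<omega>. ennreal (\<bar>\<integral>t. measure (\<mu> \<omega>) {0..t} powr (1/2) \<partial>\<nu> \<omega>\<bar> powr p) \<partial>M) < \<infinity>"
  shows "Lq_norm M p (\<lambda>\<omega>. \<integral>t. measure (\<mu> \<omega>) {0..t} powr (-1/2) \<partial>\<mu> \<omega>)
         * Lq_norm M p (\<lambda>\<omega>. \<integral>t. measure (\<mu> \<omega>) {0..t} powr (1/2) \<partial>\<nu> \<omega>)
       \<le> ennreal (2 * p) * Lq_norm M (p/2) (\<lambda>\<omega>. measure (\<mu> \<omega>) {0..T}) * bmo_norm M F T \<nu>"
proof -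
  interpret stochastic_basis M F T by fact
  note \<mu> = assms(2) and \<nu> = assms(3) and p = assms(7)
  define w where "w \<omega> t = measure (\<mu> \<omega>) {0..t} powr (1/2)" for \<omega> t
  define W where "W \<omega> = w \<omega> T" for \<omega>
  define X where "X \<omega> = (\<integral>t. w \<omega> t \<partial>\<nu> \<omega>)" for \<omega>
  define J where "J \<omega> = (\<integral>t. measure (\<mu> \<omega>) {0..t} powr (-1/2) \<partial>\<mu> \<omega>)" for \<omega>
  define B where "B = bmo_norm M F T \<nu>"
  have w_meas: "(\<lambda>\<omega>. w \<omega> t) \<in> borel_measurable (F t)" if "t \<in> {0..T}" for t
    using adapted_measurable_F[OF \<mu> that] by (simp add: w_def)
  have W_meas [measurable]: "W \<in> borel_measurable M"
    using w_meas[of T] T_pos by (auto simp: W_def[abs_def] intro: measurable_F_M)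
  have w_mono: "mono_on {0..T} (w \<omega>)"
    and w_cont: "continuous_on {0..T} (w \<omega>)" and W_pos: "0 < W \<omega>"
    and J_le: "J \<omega> \<le> 2 * W \<omega>" if "\<omega> \<in> space M" for \<omega>
  proof -
    interpret interval_measure "\<mu> \<omega>" T
      by (rule interval_measure_adapted[OF \<mu> that])
    have cont: "continuous_on {0..T} (\<lambda>t. measure (\<mu> \<omega>) {0..t})"
      using assms(4) that by (simp add: continuous_paths_def)
    have pos: "0 < measure (\<mu> \<omega>) {0..t}" if "t \<in> {0..T}" for t
    proof -
      have "measure (\<mu> \<omega>) {0} \<le> measure (\<mu> \<omega>) {0..t}"
        using that by (intro finite_measure_mono borel_in_sets) auto
      then show ?thesis
        using assms(6)[OF \<open>\<omega> \<in> space M\<close>] by simp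
    qed
    show "mono_on {0..T} (w \<omega>)"
      unfolding w_def
      by (intro mono_onI powr_mono2 finite_measure_mono borel_in_sets) auto
    show "continuous_on {0..T} (w \<omega>)"
      unfolding w_def using cont pos by (intro continuous_intros) (auto dest: pos)
    show "0 < W \<omega>"
      using pos[of T] T_pos by (simp add: W_def w_def)
    show "J \<omega> \<le> 2 * W \<omega>"
      unfolding J_def W_def w_def using cont assms(6)[OF that] by (rule integral_inverse_sqrt_le)
  qed
  have J_nonneg: "0 \<le> J \<omega>" and X_nonneg: "0 \<le> X \<omega>" for \<omega>
    by (simp_all add: J_def X_def w_def)
  have X_meas [measurable]: "X \<in> borel_measurable M"
    unfolding X_def[abs_def]
    by (intro measurable_pathwise_integral[OF \<nu>] w_meas w_mono w_cont) (auto simp: w_def)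
  have main: "(\<integral>\<^sup>+\<omega>. ennreal (X \<omega> powr p) \<partial>M) \<le>
      ennreal p * (B * (\<integral>\<^sup>+\<omega>. ennreal (X \<omega> powr (p - 1) * W \<omega>) \<partial>M))"
    unfolding X_def W_def B_def
    by (intro nn_integral_pathwise_integral_powr_le[OF \<nu>] w_meas w_mono w_cont p assms(5))
      (auto simp: w_def)
  \<comment> \<open>The integrability hypothesis makes \<open>A\<close> a real number, which later
    permits division by a power of it.\<close>
  obtain A where A: "0 \<le> A" "(\<integral>\<^sup>+\<omega>. ennreal (X \<omega> powr p) \<partial>M) = ennreal A"
    using assms(8) X_nonneg
    by (cases "\<integral>\<^sup>+\<omega>. ennreal (X \<omega> powr p) \<partial>M") (auto simp: X_def w_def)
  have X_norm: "Lq_norm M p X = ennreal (A powr (1 / p))"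
    using A X_nonneg by (intro Lq_norm_finite) auto
  \<comment> \<open>Hence the \<open>p/2\<close>-norm of the total mass is the square of the p-norm
    of \<open>W\<close>.\<close>
  have W_powr: "\<bar>measure (\<mu> \<omega>) {0..T}\<bar> powr (p / 2) = W \<omega> powr p" for \<omega>
    by (simp add: W_def w_def powr_powr)
  have "Lq_norm M p J * Lq_norm M p X \<le>
      ennreal (2 * p) * Lq_norm M (p/2) (\<lambda>\<omega>. measure (\<mu> \<omega>) {0..T}) * B"
  \<comment> \<open>If \<open>A\<close> vanishes, the left-hand side is 0 even should the other
    factor be infinite.\<close>
  proof (cases "A = 0")
    case True
    then show ?thesis
      by (simp add: X_norm)
  next
    case False
    with A have A_pos: "0 < A"
      by simp
    \<comment> \<open>A zero BMO norm would force \<open>A = 0\<close> by \<open>main\<close>.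
      Together with \<open>C_nz\<close> this makes the right-hand side infinite as soon as one of
      its two norms is.\<close>
    have B: "B \<noteq> 0"
      using main A_pos A by (auto simp: ennreal_eq_0_iff)
    have C_nz: "(\<integral>\<^sup>+\<omega>. ennreal (W \<omega> powr p) \<partial>M) \<noteq> 0"
    proof
      assume "(\<integral>\<^sup>+\<omega>. ennreal (W \<omega> powr p) \<partial>M) = 0"
      then have "AE \<omega> in M. ennreal (W \<omega> powr p) = 0"
        by (subst (asm) nn_integral_0_iff_AE) auto
      then have "AE \<omega> in M. False"
        using AE_space
      proof eventually_elim
        case (elim \<omega>)
        then show ?case
          using W_pos[of \<omega>] by (auto simp: ennreal_eq_0_iff)
      qed
      then show False
        by simp
    qed
    show ?thesis
    proof (cases "(\<integral>\<^sup>+\<omega>. ennreal (W \<omega> powr p) \<partial>M) = \<infinity>")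
      case True
      then have "Lq_norm M (p/2) (\<lambda>\<omega>. measure (\<mu> \<omega>) {0..T}) = \<infinity>"
        by (intro Lq_norm_infinite) (simp only: W_powr)
      then show ?thesis
        using B p by (simp add: ennreal_mult_top ennreal_top_mult ennreal_eq_0_iff)
    next
      case False
      then obtain C where C: "0 \<le> C" "(\<integral>\<^sup>+\<omega>. ennreal (W \<omega> powr p) \<partial>M) = ennreal C"
        by (cases "\<integral>\<^sup>+\<omega>. ennreal (W \<omega> powr p) \<partial>M") auto
      with C_nz have C_pos: "0 < C"
        by (cases "C = 0") auto
      have m_norm: "Lq_norm M (p/2) (\<lambda>\<omega>. measure (\<mu> \<omega>) {0..T}) = ennreal (C powr (2 / p))"
        using C by (subst Lq_norm_finite[where I=C]) (simp_all only: W_powr, simp_all)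
      have "(\<integral>\<^sup>+\<omega>. ennreal (\<bar>J \<omega>\<bar> powr p) \<partial>M) \<le> (\<integral>\<^sup>+\<omega>. ennreal (2 powr p) * ennreal (W \<omega> powr p) \<partial>M)"
      proof (rule nn_integral_mono)
        fix \<omega> assume "\<omega> \<in> space M"
        then have "\<bar>J \<omega>\<bar> powr p \<le> (2 * W \<omega>) powr p"
          using p J_nonneg[of \<omega>] J_le by (intro powr_mono2) auto
        then show "ennreal (\<bar>J \<omega>\<bar> powr p) \<le> ennreal (2 powr p) * ennreal (W \<omega> powr p)"
          by (simp add: ennreal_mult[symmetric] W_def w_def powr_mult ennreal_leI)
      qed
      also have "\<dots> = ennreal (2 powr p * C)"
        using C by (simp add: nn_integral_cmult ennreal_mult)
      finally have J_le': "(\<integral>\<^sup>+\<omega>. ennreal (\<bar>J \<omega>\<bar> powr p) \<partial>M) \<le> ennreal (2 powr p * C)" .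
      then obtain G where G: "0 \<le> G" "(\<integral>\<^sup>+\<omega>. ennreal (\<bar>J \<omega>\<bar> powr p) \<partial>M) = ennreal G"
        by (cases "\<integral>\<^sup>+\<omega>. ennreal (\<bar>J \<omega>\<bar> powr p) \<partial>M") (auto simp: top_unique)
      have "G \<le> 2 powr p * C"
        using J_le' G C by simp
      then have "G powr (1 / p) \<le> (2 powr p * C) powr (1 / p)"
        using p G by (intro powr_mono2) auto
      also have "\<dots> = 2 * C powr (1 / p)"
        using p C by (simp add: powr_mult powr_powr)
      finally have G_le: "G powr (1 / p) \<le> 2 * C powr (1 / p)" .
      show ?thesis
      proof (cases B)
        case top
        moreover have "0 < p * C powr (2 / p)"
          using p C_pos by simp
        ultimately show ?thesis
          using p by (simp add: m_norm ennreal_mult_top ennreal_mult[symmetric] ennreal_eq_0_iff)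
      next
        case (real b)
        have "ennreal A \<le> ennreal p * (B * ennreal (A powr ((p - 1) / p) * C powr (1 / p)))"
          unfolding A(2)[symmetric]
          by (rule order_trans[OF main], intro mult_left_mono nn_integral_powr_mult_le)
            (use p A A_pos C C_pos X_nonneg W_pos in \<open>auto intro: less_imp_le\<close>)
        also have "\<dots> = ennreal (p * (b * (A powr ((p - 1) / p) * C powr (1 / p))))"
          using p real by (simp add: ennreal_mult[symmetric])
        finally have "A \<le> p * (b * (A powr ((p - 1) / p) * C powr (1 / p)))"
          using p real by simp
        \<comment> \<open>Splitting off the power that Hoelder's inequality produced lets it cancel,
          leaving the norm of \<open>X\<close> alone on the left.\<close>
        moreover have "A = A powr ((p - 1) / p) * A powr (1 / p)"
          using p A_pos by (simp add: powr_add[symmetric] add_divide_distrib[symmetric])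
        ultimately have "A powr ((p - 1) / p) * A powr (1 / p) \<le>
            A powr ((p - 1) / p) * (p * b * C powr (1 / p))"
          by (simp add: mult_ac)
        then have "A powr (1 / p) \<le> p * b * C powr (1 / p)"
          using A_pos by simp
        then have "G powr (1 / p) * A powr (1 / p) \<le> (2 * C powr (1 / p)) * (p * b * C powr (1 / p))"
          using G_le by (intro mult_mono) auto
        \<comment> \<open>Each factor contributed one p-norm of \<open>W\<close>; their product is
          the \<open>p/2\<close>-norm of the total mass of \<open>\<mu>\<close>.\<close>
        also have "\<dots> = 2 * p * C powr (2 / p) * b"
          by (simp add: powr_add[symmetric] mult_ac)
        finally have "ennreal (G powr (1 / p) * A powr (1 / p)) \<le> ennreal (2 * p * C powr (2 / p) * b)"
          by (rule ennreal_leI)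
        then show ?thesis
          using G p real by (simp add: X_norm Lq_norm_finite[OF G(2,1)] m_norm ennreal_mult)
      qed
    qed
  qed
  then show ?thesis
    by (simp add: X_def[abs_def] J_def[abs_def] w_def[abs_def] B_def)
qed

end
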